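(* Let $n$ be a natural number with $n\geq 7$. Then: (1) for every integer $j$ with $1\leq j\leq n-1$, the triple $(2^{j},n,n)$ is CFI--representable; (2) if $n\neq 8$, then, for every integer $k$ with $2\leq k\leq n+1$, the triple $(k,n,n)$ is CFI--representable.
   Context: All lattices are non-empty. For a lattice $L$, $\mathrm{Con}(L)$ denotes the lattice of congruences of $L$, $\mathrm{Filt}(L)$ the lattice of (non-empty) filters of $L$ and $\mathrm{Id}(L)$ the lattice of (non-empty) ideals of $L$. A triple $(\kappa,\lambda,\mu)$ of nonzero cardinalities is called CFI--representable iff there exists a lattice $L$ such that $\kappa=|\mathrm{Con}(L)|$, $\lambda=|\mathrm{Filt}(L)|$ and $\mu=|\mathrm{Id}(L)|$. In a finite lattice all filters and all ideals are principal, so $|\mathrm{Filt}(L)|=|\mathrm{Id}(L)|=|L|$; thus, for positive integers $k,n$, the triple $(k,n,n)$ is CFI--representable iff there exists a lattice $L$ with $|L|=n$ and $|\mathrm{Con}(L)|=k$. *)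

theory Defs
  imports "HOL-Algebra.Lattice"
begin

unbundle cardinal_syntax

definition Con_lat :: "'a gorder \<Rightarrow> 'a rel set" where
  "Con_lat L = {\<theta>. equiv (carrier L) \<theta> \<and>
     (\<forall>a b c d. (a, b) \<in> \<theta> \<longrightarrow> (c, d) \<in> \<theta> \<longrightarrow>
        (a \<squnion>\<^bsub>L\<^esub> c, b \<squnion>\<^bsub>L\<^esub> d) \<in> \<theta> \<and> (a \<sqinter>\<^bsub>L\<^esub> c, b \<sqinter>\<^bsub>L\<^esub> d) \<in> \<theta>)}"

definition Filt_lat :: "'a gorder \<Rightarrow> 'a set set" where
  "Filt_lat L = {F. F \<subseteq> carrier L \<and> F \<noteq> {} \<and>
     (\<forall>x\<in>F. \<forall>y\<in>F. x \<sqinter>\<^bsub>L\<^esub> y \<in> F) \<and>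
     (\<forall>x\<in>F. \<forall>y\<in>carrier L. x \<sqsubseteq>\<^bsub>L\<^esub> y \<longrightarrow> y \<in> F)}"

definition Id_lat :: "'a gorder \<Rightarrow> 'a set set" where
  "Id_lat L = {I. I \<subseteq> carrier L \<and> I \<noteq> {} \<and>
     (\<forall>x\<in>I. \<forall>y\<in>I. x \<squnion>\<^bsub>L\<^esub> y \<in> I) \<and>
     (\<forall>x\<in>I. \<forall>y\<in>carrier L. y \<sqsubseteq>\<^bsub>L\<^esub> x \<longrightarrow> y \<in> I)}"

(* Cardinalities are cardinal orders, as in the library; a natural number k is the cardinality
   of {..<k}.  HOL cannot quantify over the type of the elements of L, so the witness is sought
   in the type underlying lam.  This loses nothing: an element is determined by its principal filter,
   so L has at most lam elements; CFI_representableI below makes this precise.  The three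
   cardinalities are automatically nonzero because L is non-empty. *)
definition CFI_representable :: "'k rel \<Rightarrow> 'l rel \<Rightarrow> 'm rel \<Rightarrow> bool" where
  "CFI_representable \<kappa> lam \<mu> \<longleftrightarrow>
     (\<exists>L :: 'l gorder. lattice L \<and> carrier L \<noteq> {} \<and>
        |Con_lat L| =o \<kappa> \<and> |Filt_lat L| =o lam \<and> |Id_lat L| =o \<mu>)"

lemma lattice_transport:
  fixes L :: "'a gorder" and f :: "'a \<Rightarrow> 'b"
  assumes "lattice L" and inj: "inj_on f (carrier L)"
  obtains K :: "'b gorder" where "lattice K" "carrier K = f ` carrier L"
    "\<And>x y. x \<in> carrier L \<Longrightarrow> y \<in> carrier L \<Longrightarrow> f x \<sqsubseteq>\<^bsub>K\<^esub> f y \<longleftrightarrow> x \<sqsubseteq>\<^bsub>L\<^esub> y"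
    "\<And>x y. x \<in> carrier L \<Longrightarrow> y \<in> carrier L \<Longrightarrow> f x \<squnion>\<^bsub>K\<^esub> f y = f (x \<squnion>\<^bsub>L\<^esub> y)"
    "\<And>x y. x \<in> carrier L \<Longrightarrow> y \<in> carrier L \<Longrightarrow> f x \<sqinter>\<^bsub>K\<^esub> f y = f (x \<sqinter>\<^bsub>L\<^esub> y)"
proof -
  interpret L: lattice L by fact
  define g where "g = inv_into (carrier L) f"
  have g [simp]: "g (f x) = x" if "x \<in> carrier L" for x
    using that inj by (simp add: g_def)
  define K :: "'b gorder" where
    "K = \<lparr>carrier = f ` carrier L, eq = (=), le = (\<lambda>x y. g x \<sqsubseteq>\<^bsub>L\<^esub> g y)\<rparr>"
  have carK: "carrier K = f ` carrier L" by (simp add: K_def)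
  have eqK: "eq K = (=)" by (simp add: K_def)
  have leK: "f x \<sqsubseteq>\<^bsub>K\<^esub> f y \<longleftrightarrow> x \<sqsubseteq>\<^bsub>L\<^esub> y" if "x \<in> carrier L" "y \<in> carrier L" for x y
    using that by (simp add: K_def)
  interpret K: partial_order K
    by unfold_locales
      (auto simp: carK eqK leK dest: L.le_antisym intro: L.le_trans)
  have lub: "least K (f (x \<squnion>\<^bsub>L\<^esub> y)) (Upper K {f x, f y})"
    if "x \<in> carrier L" "y \<in> carrier L" for x y
  proof -
    have "Upper K {f x, f y} = f ` {z \<in> carrier L. x \<sqsubseteq>\<^bsub>L\<^esub> z \<and> y \<sqsubseteq>\<^bsub>L\<^esub> z}"
      using that by (force simp: Upper_def carK leK)
    then show ?thesis
      using that by (auto simp: least_def carK leK L.join_left L.join_right L.join_le)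
  qed
  have glb: "greatest K (f (x \<sqinter>\<^bsub>L\<^esub> y)) (Lower K {f x, f y})"
    if "x \<in> carrier L" "y \<in> carrier L" for x y
  proof -
    have "Lower K {f x, f y} = f ` {z \<in> carrier L. z \<sqsubseteq>\<^bsub>L\<^esub> x \<and> z \<sqsubseteq>\<^bsub>L\<^esub> y}"
      using that by (force simp: Lower_def carK leK)
    then show ?thesis
      using that by (auto simp: greatest_def carK leK L.meet_left L.meet_right L.meet_le)
  qed
  have latK: "lattice K"
    by unfold_locales (auto simp: carK intro: lub glb)
  have joinK: "f x \<squnion>\<^bsub>K\<^esub> f y = f (x \<squnion>\<^bsub>L\<^esub> y)"
    if "x \<in> carrier L" "y \<in> carrier L" for x y
    unfolding join_def[of K] sup_def
    by (rule some_equality[where P = "\<lambda>s. least K s (Upper K {f x, f y})", OF lub[OF that]])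
      (metis K.eq_is_equal K.weak_least_unique lub[OF that])
  have meetK: "f x \<sqinter>\<^bsub>K\<^esub> f y = f (x \<sqinter>\<^bsub>L\<^esub> y)"
    if "x \<in> carrier L" "y \<in> carrier L" for x y
    unfolding meet_def[of K] inf_def
    by (rule some_equality[where P = "\<lambda>s. greatest K s (Lower K {f x, f y})", OF glb[OF that]])
      (metis K.eq_is_equal K.weak_greatest_unique glb[OF that])
  show thesis by (rule that[OF latK carK leK joinK meetK])
qed

lemma bij_betw_subsets_transport:
  assumes "inj_on f A" "\<And>X. X \<subseteq> A \<Longrightarrow> P X \<longleftrightarrow> Q (f ` X)"
  shows "|{X. X \<subseteq> A \<and> P X}| =o |{Y. Y \<subseteq> f ` A \<and> Q Y}|"
proof -
  have "bij_betw (image f) {X. X \<subseteq> A \<and> P X} {Y. Y \<subseteq> f ` A \<and> Q Y}"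
    unfolding bij_betw_def
  proof
    show "inj_on (image f) {X. X \<subseteq> A \<and> P X}"
      by (rule inj_on_subset[OF inj_on_image_Pow[OF assms(1)]]) auto
    show "image f ` {X. X \<subseteq> A \<and> P X} = {Y. Y \<subseteq> f ` A \<and> Q Y}"
      using assms(2) by (auto simp: subset_image_iff)
  qed
  then show ?thesis using card_of_ordIso by blast
qed

lemma Con_lat_alt:
  "Con_lat M = {\<theta>. \<theta> \<subseteq> carrier M \<times> carrier M \<and>
      ((\<forall>x\<in>carrier M. (x, x) \<in> \<theta>) \<and>
       (\<forall>x\<in>carrier M. \<forall>y\<in>carrier M. (x, y) \<in> \<theta> \<longrightarrow> (y, x) \<in> \<theta>) \<and>
       (\<forall>x\<in>carrier M. \<forall>y\<in>carrier M. \<forall>z\<in>carrier M.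
          (x, y) \<in> \<theta> \<longrightarrow> (y, z) \<in> \<theta> \<longrightarrow> (x, z) \<in> \<theta>) \<and>
       (\<forall>a\<in>carrier M. \<forall>b\<in>carrier M. \<forall>c\<in>carrier M. \<forall>d\<in>carrier M.
          (a, b) \<in> \<theta> \<longrightarrow> (c, d) \<in> \<theta> \<longrightarrow>
            (a \<squnion>\<^bsub>M\<^esub> c, b \<squnion>\<^bsub>M\<^esub> d) \<in> \<theta> \<and> (a \<sqinter>\<^bsub>M\<^esub> c, b \<sqinter>\<^bsub>M\<^esub> d) \<in> \<theta>))}" (is "_ = ?R")
proof (rule Set.set_eqI, rule iffI)
  fix \<theta> assume "\<theta> \<in> Con_lat M"
  then show "\<theta> \<in> ?R"
    unfolding Con_lat_def equiv_def refl_on_def mem_Collect_eq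
    by (meson symD transD)
next
  fix \<theta> assume *: "\<theta> \<in> ?R"
  then have sub: "x \<in> carrier M" "y \<in> carrier M" if "(x, y) \<in> \<theta>" for x y
    using that by auto
  from * have "sym \<theta>" by (auto intro!: symI dest: sub)
  moreover from * have "trans \<theta>" unfolding mem_Collect_eq by (intro transI) (meson sub)
  ultimately show "\<theta> \<in> Con_lat M"
    using * unfolding Con_lat_def equiv_def refl_on_def mem_Collect_eq by (meson sub)
qed

lemma CFI_representableI:
  fixes L :: "'a gorder" and \<kappa> :: "'k rel" and lam :: "'l rel" and \<mu> :: "'m rel"
  assumes "lattice L" "carrier L \<noteq> {}"
    and Con: "|Con_lat L| =o \<kappa>" and Filt: "|Filt_lat L| =o lam" and Id: "|Id_lat L| =o \<mu>"
  shows "CFI_representable \<kappa> lam \<mu>"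
proof -
  interpret L: lattice L by fact
  let ?A = "carrier L"
  define up where "up x = {y \<in> ?A. x \<sqsubseteq>\<^bsub>L\<^esub> y}" for x
  have "up ` ?A \<subseteq> Filt_lat L"
    unfolding up_def Filt_lat_def by (auto intro: L.meet_le L.le_trans)
  moreover have "inj_on up ?A"
  proof (rule inj_onI)
    fix x y assume xy: "x \<in> ?A" "y \<in> ?A" and eq: "up x = up y"
    from xy have "x \<in> up x" "y \<in> up y" by (simp_all add: up_def)
    with eq have "x \<in> up y" "y \<in> up x" by simp_all
    then show "x = y"
      by (auto simp: up_def intro: L.le_antisym)
  qed
  ultimately have "|?A| \<le>o |Filt_lat L|"
    using card_of_ordLeq by blast
  also have "|Filt_lat L| =o |Field lam|"
  proof -
    have "Card_order lam"
      using Filt card_of_Card_order Card_order_ordIso ordIso_symmetric by blast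
    then show ?thesis
      using Filt card_of_Field_ordIso ordIso_symmetric ordIso_transitive by blast
  qed
  finally obtain f :: "'a \<Rightarrow> 'l" where inj: "inj_on f ?A"
    using card_of_ordLeq[of ?A "Field lam"] by blast
  obtain K :: "'l gorder" where "lattice K" and car: "carrier K = f ` ?A"
    and le: "\<And>x y. x \<in> ?A \<Longrightarrow> y \<in> ?A \<Longrightarrow> f x \<sqsubseteq>\<^bsub>K\<^esub> f y \<longleftrightarrow> x \<sqsubseteq>\<^bsub>L\<^esub> y"
    and join: "\<And>x y. x \<in> ?A \<Longrightarrow> y \<in> ?A \<Longrightarrow> f x \<squnion>\<^bsub>K\<^esub> f y = f (x \<squnion>\<^bsub>L\<^esub> y)"
    and meet: "\<And>x y. x \<in> ?A \<Longrightarrow> y \<in> ?A \<Longrightarrow> f x \<sqinter>\<^bsub>K\<^esub> f y = f (x \<sqinter>\<^bsub>L\<^esub> y)"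
    using lattice_transport[OF \<open>lattice L\<close> inj] by blast
  have mem: "f x \<in> f ` X \<longleftrightarrow> x \<in> X" if "x \<in> ?A" "X \<subseteq> ?A" for x X
    using inj that by (meson inj_on_image_mem_iff)
  have sub: "x \<in> ?A" if "x \<in> X" "X \<subseteq> ?A" for x X
    using that by blast
  have Filt': "|Filt_lat L| =o |Filt_lat K|"
    unfolding Filt_lat_def car
  proof (rule bij_betw_subsets_transport[OF inj])
    fix X assume X: "X \<subseteq> ?A"
    have "(\<forall>x\<in>X. \<forall>y\<in>X. x \<sqinter>\<^bsub>L\<^esub> y \<in> X) \<longleftrightarrow> (\<forall>u\<in>f ` X. \<forall>v\<in>f ` X. u \<sqinter>\<^bsub>K\<^esub> v \<in> f ` X)"
      by (simp add: meet mem X sub[OF _ X] L.meet_closed)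
    moreover have "(\<forall>x\<in>X. \<forall>y\<in>?A. x \<sqsubseteq>\<^bsub>L\<^esub> y \<longrightarrow> y \<in> X) \<longleftrightarrow>
        (\<forall>u\<in>f ` X. \<forall>v\<in>f ` ?A. u \<sqsubseteq>\<^bsub>K\<^esub> v \<longrightarrow> v \<in> f ` X)"
      by (simp add: le mem X sub[OF _ X])
    ultimately show "(X \<noteq> {} \<and> (\<forall>x\<in>X. \<forall>y\<in>X. x \<sqinter>\<^bsub>L\<^esub> y \<in> X) \<and>
          (\<forall>x\<in>X. \<forall>y\<in>?A. x \<sqsubseteq>\<^bsub>L\<^esub> y \<longrightarrow> y \<in> X)) \<longleftrightarrow>
        (f ` X \<noteq> {} \<and> (\<forall>u\<in>f ` X. \<forall>v\<in>f ` X. u \<sqinter>\<^bsub>K\<^esub> v \<in> f ` X) \<and>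
          (\<forall>u\<in>f ` X. \<forall>v\<in>f ` ?A. u \<sqsubseteq>\<^bsub>K\<^esub> v \<longrightarrow> v \<in> f ` X))"
      by (intro arg_cong2[where f = "(\<and>)"]) (simp_all only: image_is_empty)
  qed
  have Id': "|Id_lat L| =o |Id_lat K|"
    unfolding Id_lat_def car
  proof (rule bij_betw_subsets_transport[OF inj])
    fix X assume X: "X \<subseteq> ?A"
    have "(\<forall>x\<in>X. \<forall>y\<in>X. x \<squnion>\<^bsub>L\<^esub> y \<in> X) \<longleftrightarrow> (\<forall>u\<in>f ` X. \<forall>v\<in>f ` X. u \<squnion>\<^bsub>K\<^esub> v \<in> f ` X)"
      by (simp add: join mem X sub[OF _ X] L.join_closed)
    moreover have "(\<forall>x\<in>X. \<forall>y\<in>?A. y \<sqsubseteq>\<^bsub>L\<^esub> x \<longrightarrow> y \<in> X) \<longleftrightarrow>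
        (\<forall>u\<in>f ` X. \<forall>v\<in>f ` ?A. v \<sqsubseteq>\<^bsub>K\<^esub> u \<longrightarrow> v \<in> f ` X)"
      by (simp add: le mem X sub[OF _ X])
    ultimately show "(X \<noteq> {} \<and> (\<forall>x\<in>X. \<forall>y\<in>X. x \<squnion>\<^bsub>L\<^esub> y \<in> X) \<and>
          (\<forall>x\<in>X. \<forall>y\<in>?A. y \<sqsubseteq>\<^bsub>L\<^esub> x \<longrightarrow> y \<in> X)) \<longleftrightarrow>
        (f ` X \<noteq> {} \<and> (\<forall>u\<in>f ` X. \<forall>v\<in>f ` X. u \<squnion>\<^bsub>K\<^esub> v \<in> f ` X) \<and>
          (\<forall>u\<in>f ` X. \<forall>v\<in>f ` ?A. v \<sqsubseteq>\<^bsub>K\<^esub> u \<longrightarrow> v \<in> f ` X))"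
      by (intro arg_cong2[where f = "(\<and>)"]) (simp_all only: image_is_empty)
  qed
  let ?ff = "map_prod f f"
  have inj2: "inj_on ?ff (?A \<times> ?A)"
    by (rule map_prod_inj_on[OF inj inj])
  have memp: "(f x, f y) \<in> ?ff ` \<theta> \<longleftrightarrow> (x, y) \<in> \<theta>"
    if "x \<in> ?A" "y \<in> ?A" "\<theta> \<subseteq> ?A \<times> ?A" for x y \<theta>
    using inj_on_image_mem_iff[OF inj2 _ that(3), of "(x, y)"] that by simp
  have img: "f ` ?A \<times> f ` ?A = ?ff ` (?A \<times> ?A)"
    by (simp add: map_prod_surj_on[OF refl refl])
  have Con': "|Con_lat L| =o |Con_lat K|"
    unfolding Con_lat_alt car img
    by (rule bij_betw_subsets_transport[OF inj2])
      (simp only: ball_simps memp join meet L.join_closed L.meet_closed cong: ball_cong)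
  have "carrier K \<noteq> {}"
    using car assms(2) by simp
  moreover have "|Con_lat K| =o \<kappa>" "|Filt_lat K| =o lam" "|Id_lat K| =o \<mu>"
    using Con' Filt' Id' Con Filt Id ordIso_symmetric ordIso_transitive by blast+
  ultimately show ?thesis
    unfolding CFI_representable_def using \<open>lattice K\<close> by blast
qed

end

theory Submission
  imports Defs
begin

text \<open>
  The sizes and congruence numbers of finite lattices are closed under a few constructions, and
  everything asked for is reached from the one-element lattice by means of them. Write
  \<open>(n, k)\<close> for a lattice with \<open>n\<close> elements and \<open>k\<close> congruences.

  \<^item> Glued sum: if the top of one lattice is identified with the bottom of another one, the
    congruences of the result are the pairs of congruences of the two parts. Gluing a two-element
    chain on top turns \<open>(n, k)\<close> into \<open>(n + 1, 2k)\<close>; gluing the four-element Boolean lattice on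
    top turns it into \<open>(n + 3, 4k)\<close> (\<open>realizable_double\<close>, \<open>realizable_quadruple\<close>).

  \<^item> Horizontal extension: add a new bottom, a new top and \<open>r \<ge> 1\<close> pairwise incomparable
    elements, each of them a complement of every old element. For \<open>r \<ge> 2\<close> any collapse of the
    new bottom or the new top with something else spreads to the whole lattice, just as in the
    diamond \<open>M\<^sub>3\<close>, so that only the full congruence is added: this gives \<open>(n + r + 2, k + 1)\<close>. For
    \<open>r = 1\<close> there are also two congruences with two classes, just as in the pentagon \<open>N\<^sub>5\<close>:
    this gives \<open>(n + 3, k + 3)\<close> (\<open>realizable_horizontal\<close>).

  Powers of two: chains, the lattices \<open>M\<^sub>r\<close> with \<open>r \<ge> 3\<close> and the Boolean square, with chains glued
  on top, give \<open>2\<^sup>i\<close> for every \<open>i\<close> from \<open>1\<close> to \<open>n - 1\<close> except \<open>n - 3\<close>. Two Boolean squares, one on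
  top of the other, give \<open>(7, 16)\<close>, and by doubling the missing exponent for all \<open>n \<ge> 7\<close>.

  Small numbers: induct on \<open>n\<close>. An even \<open>k\<close> comes from \<open>(n - 1, k / 2)\<close> by doubling, and an odd
  \<open>k\<close> from \<open>(n - 3, k - 3)\<close> by the horizontal extension with \<open>r = 1\<close>. The numbers \<open>k\<close> too small
  for this, and the sizes \<open>n < 10\<close> at which the induction starts, are covered by the numbers
  \<open>2\<^sup>i + 1\<close> of a horizontally extended chain and by a few explicit lattices. The pair \<open>(8, 7)\<close> is
  not produced this way, and the induction steps never lead back to it: doubling it would give
  \<open>k = 14\<close> at \<open>n = 9\<close>, which is out of range, and adding \<open>3\<close> to it would give the even number \<open>10\<close>.
\<close>

section \<open>Lattices as algebras and their congruences\<close>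

text \<open>
  The equational presentation makes duality immediate: exchanging the two operations gives the
  dual lattice with the same congruences, so that each argument about bottoms also serves for tops.
\<close>

locale lattice_ops =
  fixes A :: "'a set" and j m :: "'a \<Rightarrow> 'a \<Rightarrow> 'a"
  assumes j_closed [simp]: "x \<in> A \<Longrightarrow> y \<in> A \<Longrightarrow> j x y \<in> A"
    and m_closed [simp]: "x \<in> A \<Longrightarrow> y \<in> A \<Longrightarrow> m x y \<in> A"
    and j_comm: "x \<in> A \<Longrightarrow> y \<in> A \<Longrightarrow> j x y = j y x"
    and m_comm: "x \<in> A \<Longrightarrow> y \<in> A \<Longrightarrow> m x y = m y x"
    and j_assoc: "x \<in> A \<Longrightarrow> y \<in> A \<Longrightarrow> z \<in> A \<Longrightarrow> j (j x y) z = j x (j y z)"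
    and m_assoc: "x \<in> A \<Longrightarrow> y \<in> A \<Longrightarrow> z \<in> A \<Longrightarrow> m (m x y) z = m x (m y z)"
    and j_absorb [simp]: "x \<in> A \<Longrightarrow> y \<in> A \<Longrightarrow> j x (m x y) = x"
    and m_absorb [simp]: "x \<in> A \<Longrightarrow> y \<in> A \<Longrightarrow> m x (j x y) = x"
begin

lemma dual: "lattice_ops A m j"
  by unfold_locales (auto intro: j_comm m_comm j_assoc m_assoc)

lemma j_idem [simp]: "x \<in> A \<Longrightarrow> j x x = x"
  by (metis j_absorb m_absorb j_closed)

lemma m_idem [simp]: "x \<in> A \<Longrightarrow> m x x = x"
  by (metis j_absorb m_absorb m_closed)

lemma m_eq_iff: "x \<in> A \<Longrightarrow> y \<in> A \<Longrightarrow> m x y = x \<longleftrightarrow> j x y = y"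
  by (metis j_absorb m_absorb j_comm m_comm)

end

locale bounded_lattice_ops = lattice_ops +
  fixes b t
  assumes b_in [simp]: "b \<in> A" and t_in [simp]: "t \<in> A"
    and b_neutral [simp]: "x \<in> A \<Longrightarrow> j b x = x"
    and t_neutral [simp]: "x \<in> A \<Longrightarrow> m t x = x"
begin

lemma b_least [simp]: "x \<in> A \<Longrightarrow> m b x = b"
  by (metis b_neutral m_absorb b_in)

lemma t_greatest [simp]: "x \<in> A \<Longrightarrow> j t x = t"
  by (metis t_neutral j_absorb t_in)

lemma b_neutral' [simp]: "x \<in> A \<Longrightarrow> j x b = x"
  by (metis b_neutral j_comm b_in)

lemma t_neutral' [simp]: "x \<in> A \<Longrightarrow> m x t = x"
  by (metis t_neutral m_comm t_in)

lemma b_least' [simp]: "x \<in> A \<Longrightarrow> m x b = b"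
  by (metis b_least m_comm b_in)

lemma t_greatest' [simp]: "x \<in> A \<Longrightarrow> j x t = t"
  by (metis t_greatest j_comm t_in)

end

text \<open>
  Compatibility is required in one argument only. By transitivity and commutativity this amounts to
  compatibility in both arguments, and it leaves fewer elements in each case distinction.
\<close>

definition congs :: "'a set \<Rightarrow> ('a \<Rightarrow> 'a \<Rightarrow> 'a) \<Rightarrow> ('a \<Rightarrow> 'a \<Rightarrow> 'a) \<Rightarrow> 'a rel set" where
  "congs A j m = {\<theta>. equiv A \<theta> \<and>
     (\<forall>a c. (a, c) \<in> \<theta> \<longrightarrow> (\<forall>x\<in>A. (j a x, j c x) \<in> \<theta> \<and> (m a x, m c x) \<in> \<theta>))}"

lemma congsI:
  assumes "\<theta> \<subseteq> A \<times> A" "\<And>x. x \<in> A \<Longrightarrow> (x, x) \<in> \<theta>"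
    "\<And>x y. (x, y) \<in> \<theta> \<Longrightarrow> (y, x) \<in> \<theta>"
    "\<And>x y z. (x, y) \<in> \<theta> \<Longrightarrow> (y, z) \<in> \<theta> \<Longrightarrow> (x, z) \<in> \<theta>"
    "\<And>x y z. (x, y) \<in> \<theta> \<Longrightarrow> z \<in> A \<Longrightarrow> (j x z, j y z) \<in> \<theta>"
    "\<And>x y z. (x, y) \<in> \<theta> \<Longrightarrow> z \<in> A \<Longrightarrow> (m x z, m y z) \<in> \<theta>"
  shows "\<theta> \<in> congs A j m"
proof -
  have "equiv A \<theta>"
    by (rule equivI[OF assms(1) refl_onI symI transI]) (fact assms)+
  then show ?thesis
    unfolding congs_def using assms(5,6) by simp
qed

lemma congsD:
  assumes "\<theta> \<in> congs A j m"
  shows congs_sub: "\<And>x y. (x, y) \<in> \<theta> \<Longrightarrow> x \<in> A \<and> y \<in> A"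
    and congs_refl: "\<And>x. x \<in> A \<Longrightarrow> (x, x) \<in> \<theta>"
    and congs_sym: "\<And>x y. (x, y) \<in> \<theta> \<Longrightarrow> (y, x) \<in> \<theta>"
    and congs_trans: "\<And>x y z. (x, y) \<in> \<theta> \<Longrightarrow> (y, z) \<in> \<theta> \<Longrightarrow> (x, z) \<in> \<theta>"
    and congs_j: "\<And>x y z. (x, y) \<in> \<theta> \<Longrightarrow> z \<in> A \<Longrightarrow> (j x z, j y z) \<in> \<theta>"
    and congs_m: "\<And>x y z. (x, y) \<in> \<theta> \<Longrightarrow> z \<in> A \<Longrightarrow> (m x z, m y z) \<in> \<theta>"
  using assms unfolding congs_def by (blast dest: equiv_type equivE symD transD refl_onD)+

lemma congs_subset: "\<theta> \<in> congs A j m \<Longrightarrow> \<theta> \<subseteq> A \<times> A"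
  by (auto dest: congs_sub)

lemma rel_eqI: "(\<And>x y. (x, y) \<in> r \<longleftrightarrow> (x, y) \<in> s) \<Longrightarrow> r = s"
  by auto

lemma congs_dual: "congs A m j = congs A j m"
  unfolding congs_def by blast

lemma finite_congs: "finite A \<Longrightarrow> finite (congs A j m)"
  by (rule finite_subset[of _ "Pow (A \<times> A)"]) (auto dest: congs_sub)

lemma congs_full: 
  assumes "\<And>x y. x \<in> A \<Longrightarrow> y \<in> A \<Longrightarrow> j x y \<in> A"
    and "\<And>x y. x \<in> A \<Longrightarrow> y \<in> A \<Longrightarrow> m x y \<in> A"
  shows "A \<times> A \<in> congs A j m"
  by (rule congsI) (auto simp: assms)

lemma congs_restrict:
  assumes "\<theta> \<in> congs A' j' m'" "A \<subseteq> A'"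
    and "\<And>x y. x \<in> A \<Longrightarrow> y \<in> A \<Longrightarrow> j' x y = j x y \<and> m' x y = m x y \<and> j x y \<in> A \<and> m x y \<in> A"
  shows "\<theta> \<inter> A \<times> A \<in> congs A j m"
proof (rule congsI)
  fix x y z assume *: "(x, y) \<in> \<theta> \<inter> A \<times> A" "z \<in> A"
  then have "(j' x z, j' y z) \<in> \<theta>" "(m' x z, m' y z) \<in> \<theta>"
    using congs_j[OF assms(1)] congs_m[OF assms(1)] assms(2) by blast+
  then show "(j x z, j y z) \<in> \<theta> \<inter> A \<times> A" "(m x z, m y z) \<in> \<theta> \<inter> A \<times> A"
    using * assms(3) by auto
next
  show "(x, z) \<in> \<theta> \<inter> A \<times> A" if "(x, y) \<in> \<theta> \<inter> A \<times> A" "(y, z) \<in> \<theta> \<inter> A \<times> A" for x y z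
    using that congs_trans[OF assms(1), of x y z] by simp
qed (use assms(2) congs_refl[OF assms(1)] congs_sym[OF assms(1)] in auto)

definition hom_into :: "'a set \<Rightarrow> ('a \<Rightarrow> 'a \<Rightarrow> 'a) \<Rightarrow> ('a \<Rightarrow> 'a \<Rightarrow> 'a) \<Rightarrow>
    'b set \<Rightarrow> ('b \<Rightarrow> 'b \<Rightarrow> 'b) \<Rightarrow> ('b \<Rightarrow> 'b \<Rightarrow> 'b) \<Rightarrow> ('a \<Rightarrow> 'b) \<Rightarrow> bool" where
  "hom_into A j m B j' m' f \<longleftrightarrow> (\<forall>x\<in>A. f x \<in> B \<and>
     (\<forall>y\<in>A. j x y \<in> A \<and> m x y \<in> A \<and> f (j x y) = j' (f x) (f y) \<and> f (m x y) = m' (f x) (f y)))"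

definition pullback :: "'a set \<Rightarrow> ('a \<Rightarrow> 'b) \<Rightarrow> 'b rel \<Rightarrow> 'a rel" where
  "pullback A f \<theta> = {(x, y). x \<in> A \<and> y \<in> A \<and> (f x, f y) \<in> \<theta>}"

lemma congs_pullback:
  assumes "hom_into A j m B j' m' f" "\<theta> \<in> congs B j' m'"
  shows "pullback A f \<theta> \<in> congs A j m"
proof (rule congsI)
  show "(x, z) \<in> pullback A f \<theta>" if "(x, y) \<in> pullback A f \<theta>" "(y, z) \<in> pullback A f \<theta>" for x y z
    using that congs_trans[OF assms(2), of "f x" "f y" "f z"] by (simp add: pullback_def)
qed (use assms(1) congs_refl[OF assms(2)] congs_sym[OF assms(2)] congs_j[OF assms(2)]
    congs_m[OF assms(2)] in \<open>auto simp: pullback_def hom_into_def\<close>)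

lemma congs_Int:
  assumes "\<alpha> \<in> congs A j m" "\<beta> \<in> congs A j m"
  shows "\<alpha> \<inter> \<beta> \<in> congs A j m"
proof (rule congsI)
  show "(x, z) \<in> \<alpha> \<inter> \<beta>" if "(x, y) \<in> \<alpha> \<inter> \<beta>" "(y, z) \<in> \<alpha> \<inter> \<beta>" for x y z
    using that congs_trans[OF assms(1), of x y z] congs_trans[OF assms(2), of x y z] by simp
qed (use congs_sub[OF assms(1)] congs_refl[OF assms(1)] congs_refl[OF assms(2)] congs_sym[OF assms(1)]
    congs_sym[OF assms(2)] congs_j[OF assms(1)] congs_j[OF assms(2)] congs_m[OF assms(1)]
    congs_m[OF assms(2)] in auto)

section \<open>Glued sums\<close>

text \<open>
  For the join, \<open>U\<close> is the upper part of the sum and its elements win; for the meet, the same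
  formula is used with \<open>U\<close> the lower part.
\<close>

definition glue :: "'a set \<Rightarrow> ('a \<Rightarrow> 'a \<Rightarrow> 'a) \<Rightarrow> 'a set \<Rightarrow> ('a \<Rightarrow> 'a \<Rightarrow> 'a) \<Rightarrow> 'a \<Rightarrow> 'a \<Rightarrow> 'a" where
  "glue U f V g x y = (if x \<in> U then if y \<in> U then f x y else x
                       else if y \<in> U then y else g x y)"

locale glued_sum = low: bounded_lattice_ops A jA mA b p + high: bounded_lattice_ops B jB mB p t
  for A :: "'a set" and jA mA b p B jB mB t +
  assumes meet_only: "A \<inter> B = {p}"
begin

abbreviation "j \<equiv> glue B jB A jA"
abbreviation "m \<equiv> glue A mA B mB"

text \<open>
  The retractions of the sum onto its two parts, that is, meet and join with the common element.
  They are homomorphisms and jointly injective, so the sum is a sublattice of the product of its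
  parts; this is why it is a lattice and where its congruences come from.
\<close>

definition "down x = (if x \<in> A then x else p)"
definition "up x = (if x \<in> B then x else p)"

lemma in_both: "x \<in> A \<Longrightarrow> x \<in> B \<Longrightarrow> x = p"
  using meet_only by blast

lemma down_up [simp]:
  "x \<in> A \<Longrightarrow> down x = x" "x \<in> A \<Longrightarrow> up x = p" "x \<in> B \<Longrightarrow> up x = x" "x \<in> B \<Longrightarrow> down x = p"
  unfolding down_def up_def using in_both by metis+

lemma glue_simps [simp]:
  "x \<in> A \<Longrightarrow> y \<in> A \<Longrightarrow> j x y = jA x y" "x \<in> A \<Longrightarrow> y \<in> A \<Longrightarrow> m x y = mA x y"
  "x \<in> B \<Longrightarrow> y \<in> B \<Longrightarrow> j x y = jB x y" "x \<in> B \<Longrightarrow> y \<in> B \<Longrightarrow> m x y = mB x y"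
  "x \<in> A \<Longrightarrow> y \<in> B \<Longrightarrow> j x y = y" "x \<in> A \<Longrightarrow> y \<in> B \<Longrightarrow> m x y = x"
  "x \<in> B \<Longrightarrow> y \<in> A \<Longrightarrow> j x y = x" "x \<in> B \<Longrightarrow> y \<in> A \<Longrightarrow> m x y = y"
  using low.t_neutral low.t_neutral' low.t_greatest low.t_greatest'
    high.b_neutral high.b_neutral' high.b_least high.b_least' low.t_in high.b_in in_both
  unfolding glue_def by metis+

lemma hom_down: "hom_into (A \<union> B) j m A jA mA down"
  unfolding hom_into_def by (intro ballI conjI; elim UnE) simp_all

lemma hom_up: "hom_into (A \<union> B) j m B jB mB up"
  unfolding hom_into_def by (intro ballI conjI; elim UnE) simp_all

lemma separate: "x \<in> A \<union> B \<Longrightarrow> y \<in> A \<union> B \<Longrightarrow> down x = down y \<Longrightarrow> up x = up y \<Longrightarrow> x = y"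
  by (metis UnE down_up)

lemma bounded: "bounded_lattice_ops (A \<union> B) j m b t"
proof -
  have d: "down x \<in> A" "up x \<in> B" if "x \<in> A \<union> B" for x
    using that by (auto simp: down_def up_def)
  have h: "down (j x y) = jA (down x) (down y)" "down (m x y) = mA (down x) (down y)"
      "up (j x y) = jB (up x) (up y)" "up (m x y) = mB (up x) (up y)"
      "j x y \<in> A \<union> B" "m x y \<in> A \<union> B"
    if "x \<in> A \<union> B" "y \<in> A \<union> B" for x y
    using hom_down hom_up that unfolding hom_into_def by blast+
  have bt: "b \<in> A \<union> B" "t \<in> A \<union> B" "down b = b" "up t = t" "up b = p" "down t = p"
    using low.b_in high.t_in in_both by (auto simp: down_def up_def)
  show ?thesis
  proof (unfold_locales, goal_cases)
    case 3 then show ?case by - (rule separate; simp only: h d low.j_comm high.j_comm)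
  next
    case 4 then show ?case by - (rule separate; simp only: h d low.m_comm high.m_comm)
  next
    case 5 then show ?case by - (rule separate; simp only: h d low.j_assoc high.j_assoc)
  next
    case 6 then show ?case by - (rule separate; simp only: h d low.m_assoc high.m_assoc)
  next
    case 7 then show ?case by - (rule separate; simp only: h d low.j_absorb high.j_absorb)
  next
    case 8 then show ?case by - (rule separate; simp only: h d low.m_absorb high.m_absorb)
  next
    case 11 then show ?case by - (rule separate; simp only: h d bt low.b_neutral high.b_neutral)
  next
    case 12 then show ?case by - (rule separate; simp only: h d bt low.t_neutral high.t_neutral)
  qed (simp_all only: h bt)
qed

text \<open>
  A congruence is determined by its two restrictions, since two elements are congruent as soon as
  their meets with \<open>p\<close> and their joins with \<open>p\<close> are: if they lie in different parts, the common
  element \<open>p\<close> is congruent to both. Conversely, the pullbacks along the two retractions realize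
  every pair of congruences.
\<close>

lemma bij_congs:
  "bij_betw (\<lambda>\<theta>. (\<theta> \<inter> A \<times> A, \<theta> \<inter> B \<times> B)) (congs (A \<union> B) j m) (congs A jA mA \<times> congs B jB mB)"
proof (rule bij_betwI[where g = "\<lambda>(\<alpha>, \<beta>). pullback (A \<union> B) down \<alpha> \<inter> pullback (A \<union> B) up \<beta>"])
  show "(\<lambda>\<theta>. (\<theta> \<inter> A \<times> A, \<theta> \<inter> B \<times> B)) \<in> congs (A \<union> B) j m \<rightarrow> congs A jA mA \<times> congs B jB mB"
    by (auto intro!: congs_restrict[of _ "A \<union> B"])
  show "(\<lambda>(\<alpha>, \<beta>). pullback (A \<union> B) down \<alpha> \<inter> pullback (A \<union> B) up \<beta>)
      \<in> congs A jA mA \<times> congs B jB mB \<rightarrow> congs (A \<union> B) j m"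
    by (auto intro!: congs_Int congs_pullback[OF hom_down] congs_pullback[OF hom_up])
next
  fix \<theta> assume \<theta>: "\<theta> \<in> congs (A \<union> B) j m"
  have dm: "down x = m x p" "up x = j x p" if "x \<in> A \<union> B" for x
    using that by (auto simp: down_def up_def glue_def dest: in_both)
  have mem: "(x, y) \<in> \<theta> \<longleftrightarrow> x \<in> A \<union> B \<and> y \<in> A \<union> B \<and>
      (down x, down y) \<in> \<theta> \<inter> A \<times> A \<and> (up x, up y) \<in> \<theta> \<inter> B \<times> B" (is "_ = ?R") for x y
  proof
    assume xy: "(x, y) \<in> \<theta>"
    then have "x \<in> A \<union> B" "y \<in> A \<union> B" using congs_sub[OF \<theta>] by blast+
    moreover from this have "(down x, down y) \<in> \<theta>" "(up x, up y) \<in> \<theta>"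
      using congs_j[OF \<theta> xy, of p] congs_m[OF \<theta> xy, of p] by (simp_all add: dm)
    ultimately show ?R by auto
  next
    assume ?R
    then show "(x, y) \<in> \<theta>"
      using congs_trans[OF \<theta>, of x p y] by auto
  qed
  show "(case (\<theta> \<inter> A \<times> A, \<theta> \<inter> B \<times> B) of (\<alpha>, \<beta>) \<Rightarrow>
      pullback (A \<union> B) down \<alpha> \<inter> pullback (A \<union> B) up \<beta>) = \<theta>"
  proof (rule Set.set_eqI)
    fix q :: "'a \<times> 'a"
    obtain x y where "q = (x, y)" by (cases q)
    then show "q \<in> (case (\<theta> \<inter> A \<times> A, \<theta> \<inter> B \<times> B) of (\<alpha>, \<beta>) \<Rightarrow>
        pullback (A \<union> B) down \<alpha> \<inter> pullback (A \<union> B) up \<beta>) \<longleftrightarrow> q \<in> \<theta>"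
      unfolding pullback_def using mem[of x y] by simp blast
  qed
next
  fix \<gamma> assume "\<gamma> \<in> congs A jA mA \<times> congs B jB mB"
  then obtain \<alpha> \<beta> where \<gamma>: "\<gamma> = (\<alpha>, \<beta>)" "\<alpha> \<in> congs A jA mA" "\<beta> \<in> congs B jB mB" by blast
  let ?\<theta> = "pullback (A \<union> B) down \<alpha> \<inter> pullback (A \<union> B) up \<beta>"
  have "(x, y) \<in> ?\<theta> \<inter> A \<times> A \<longleftrightarrow> (x, y) \<in> \<alpha>" for x y
    using congs_sub[OF \<gamma>(2), of x y] congs_refl[OF \<gamma>(3) high.b_in]
    by (cases "x \<in> A \<and> y \<in> A") (auto simp: pullback_def)
  moreover have "(x, y) \<in> ?\<theta> \<inter> B \<times> B \<longleftrightarrow> (x, y) \<in> \<beta>" for x y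
    using congs_sub[OF \<gamma>(3), of x y] congs_refl[OF \<gamma>(2) low.t_in]
    by (cases "x \<in> B \<and> y \<in> B") (auto simp: pullback_def)
  ultimately have "?\<theta> \<inter> A \<times> A = \<alpha>" "?\<theta> \<inter> B \<times> B = \<beta>"
    by (simp_all only: set_eq_iff split_paired_All simp_thms)
  then show "(\<lambda>\<theta>. (\<theta> \<inter> A \<times> A, \<theta> \<inter> B \<times> B))
      (case \<gamma> of (\<alpha>, \<beta>) \<Rightarrow> pullback (A \<union> B) down \<alpha> \<inter> pullback (A \<union> B) up \<beta>) = \<gamma>"
    unfolding \<gamma>(1) by simp
qed

end

section \<open>Horizontal extensions\<close>

text \<open>
  The element \<open>z\<close> is neutral, and two different elements that are not both in \<open>A\<close> are sent to \<open>w\<close>.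
  With \<open>z\<close> the bottom and \<open>w\<close> the top this is the join, and with the two exchanged it is the meet.
\<close>

definition horizontal_op :: "'a set \<Rightarrow> ('a \<Rightarrow> 'a \<Rightarrow> 'a) \<Rightarrow> 'a \<Rightarrow> 'a \<Rightarrow> 'a \<Rightarrow> 'a \<Rightarrow> 'a" where
  "horizontal_op A f z w x y = (if x = z then y else if y = z then x
     else if x \<in> A \<and> y \<in> A then f x y else if x = y then x else w)"

text \<open>
  The new bottom is \<open>z\<close> and the new top is \<open>e\<close>; the elements of \<open>C\<close> are both atoms and coatoms.
\<close>

locale horizontal = lattice_ops A j m for A :: "'a set" and j m +
  fixes C :: "'a set" and z e :: 'a
  assumes z_new: "z \<notin> A" "z \<notin> C" and e_new: "e \<notin> A" "e \<notin> C" and ze: "z \<noteq> e"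
    and disj: "A \<inter> C = {}" and A_ne: "A \<noteq> {}" and C_ne: "C \<noteq> {}"
begin

abbreviation "H \<equiv> insert z (insert e (A \<union> C))"
abbreviation "hj \<equiv> horizontal_op A j z e"
abbreviation "hm \<equiv> horizontal_op A m e z"

lemma horizontal_dual: "horizontal A m j C e z"
  using dual z_new e_new ze disj A_ne C_ne by (simp add: horizontal_def horizontal_axioms_def)

lemma hj_simps [simp]:
  "hj z x = x" "hj x z = x" "hj e x = e" "hj x e = e"
  "x \<in> A \<Longrightarrow> y \<in> A \<Longrightarrow> hj x y = j x y"
  "x \<in> A \<Longrightarrow> c \<in> C \<Longrightarrow> hj x c = e" "x \<in> A \<Longrightarrow> c \<in> C \<Longrightarrow> hj c x = e"
  "c \<in> C \<Longrightarrow> hj c c = c" "c \<in> C \<Longrightarrow> d \<in> C \<Longrightarrow> c \<noteq> d \<Longrightarrow> hj c d = e"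
  using z_new e_new ze disj by (auto simp: horizontal_op_def)

lemma hm_simps [simp]:
  "hm e x = x" "hm x e = x" "hm z x = z" "hm x z = z"
  "x \<in> A \<Longrightarrow> y \<in> A \<Longrightarrow> hm x y = m x y"
  "x \<in> A \<Longrightarrow> c \<in> C \<Longrightarrow> hm x c = z" "x \<in> A \<Longrightarrow> c \<in> C \<Longrightarrow> hm c x = z"
  "c \<in> C \<Longrightarrow> hm c c = c" "c \<in> C \<Longrightarrow> d \<in> C \<Longrightarrow> c \<noteq> d \<Longrightarrow> hm c d = z"
  using z_new e_new ze disj by (auto simp: horizontal_op_def)

lemma hj_C: "c \<in> C \<Longrightarrow> d \<in> C \<Longrightarrow> hj c d = (if c = d then c else e)"
  and hm_C: "c \<in> C \<Longrightarrow> d \<in> C \<Longrightarrow> hm c d = (if c = d then c else z)"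
  by simp_all

lemma hj_comm: "x \<in> H \<Longrightarrow> y \<in> H \<Longrightarrow> hj x y = hj y x"
  by (elim insertE UnE) (simp_all add: j_comm hj_C)

lemma hj_closed: "x \<in> H \<Longrightarrow> y \<in> H \<Longrightarrow> hj x y \<in> H"
  by (elim insertE UnE) (simp_all add: hj_C)

lemma hj_assoc: "x \<in> H \<Longrightarrow> y \<in> H \<Longrightarrow> u \<in> H \<Longrightarrow> hj (hj x y) u = hj x (hj y u)"
  by (elim insertE UnE) (simp_all add: j_assoc hj_C)

lemma hj_absorb: "x \<in> H \<Longrightarrow> y \<in> H \<Longrightarrow> hj x (hm x y) = x"
  by (elim insertE UnE) (simp_all add: hj_C hm_C)

lemma bounded: "bounded_lattice_ops H hj hm z e"
proof -
  interpret d: horizontal A m j C e z by (rule horizontal_dual)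
  have H: "d.H = H" by blast
  note dual_facts = d.hj_closed d.hj_comm d.hj_assoc d.hj_absorb
  show ?thesis
    by (unfold_locales; (rule hj_closed hj_comm hj_assoc hj_absorb dual_facts[unfolded H]; assumption)?)
      simp_all
qed

lemma hj_cong_extend:
  assumes \<alpha>: "\<alpha> \<in> congs A j m" and xy: "(x, y) \<in> \<alpha> \<union> Id_on H" and u: "u \<in> H"
  shows "(hj x u, hj y u) \<in> \<alpha> \<union> Id_on H"
proof (cases "x = y")
  case True
  with xy have "x \<in> H" using congs_sub[OF \<alpha>] by blast
  then show ?thesis using True hj_closed[OF _ u] by blast
next
  case False
  then have "(x, y) \<in> \<alpha>" using xy by blast
  moreover from this have "x \<in> A" "y \<in> A" using congs_sub[OF \<alpha>] by blast+
  ultimately show ?thesis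
    using u congs_j[OF \<alpha>, of x y u] by (elim insertE UnE) (simp_all add: Id_on_iff)
qed

text \<open>
  A congruence of the old lattice stays one after adding singleton classes, because the join of an
  old element with a new one does not depend on the old one, or is that old element itself.
\<close>

lemma cong_extend:
  assumes \<alpha>: "\<alpha> \<in> congs A j m"
  shows "\<alpha> \<union> Id_on H \<in> congs H hj hm"
proof (rule congsI)
  interpret d: horizontal A m j C e z by (rule horizontal_dual)
  have H: "d.H = H" by blast
  show "(hm x u, hm y u) \<in> \<alpha> \<union> Id_on H" if "(x, y) \<in> \<alpha> \<union> Id_on H" "u \<in> H" for x y u
    using d.hj_cong_extend[of \<alpha> x y u] that \<alpha> unfolding H by (simp add: congs_dual[of A j m])
  show "(x, v) \<in> \<alpha> \<union> Id_on H" if "(x, y) \<in> \<alpha> \<union> Id_on H" "(y, v) \<in> \<alpha> \<union> Id_on H" for x y v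
    using that congs_trans[OF \<alpha>, of x y v] by auto
  show "\<alpha> \<union> Id_on H \<subseteq> H \<times> H" by (auto dest: congs_sub[OF \<alpha>])
  show "(y, x) \<in> \<alpha> \<union> Id_on H" if "(x, y) \<in> \<alpha> \<union> Id_on H" for x y
    using that congs_sym[OF \<alpha>, of x y] by auto
qed (use hj_cong_extend[OF \<alpha>] in blast)+

text \<open>
  The congruences that come from the old lattice are exactly those in which the new bottom and the
  new top form singleton classes.
\<close>

definition "bounds_isolated = {\<theta> \<in> congs H hj hm.
   \<forall>x\<in>H. ((z, x) \<in> \<theta> \<longrightarrow> x = z) \<and> ((x, e) \<in> \<theta> \<longrightarrow> x = e)}"

lemma bounds_isolated_eq: "bounds_isolated = (\<lambda>\<alpha>. \<alpha> \<union> Id_on H) ` congs A j m"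
proof (intro equalityI subsetI)
  fix \<theta> assume "\<theta> \<in> bounds_isolated"
  then have \<theta>: "\<theta> \<in> congs H hj hm"
    and isolated: "\<forall>x\<in>H. ((z, x) \<in> \<theta> \<longrightarrow> x = z) \<and> ((x, e) \<in> \<theta> \<longrightarrow> x = e)"
    unfolding bounds_isolated_def by blast+
  have iso: "(z, x) \<in> \<theta> \<Longrightarrow> x = z" "(x, e) \<in> \<theta> \<Longrightarrow> x = e" for x
    using isolated congs_sub[OF \<theta>, of z x] congs_sub[OF \<theta>, of x e] by blast+
  \<comment> \<open>if \<open>x\<close> is in \<open>C\<close>, meeting both sides with \<open>x\<close> makes \<open>x\<close> congruent to the bottom\<close>
  have mem_A: "x \<in> A" if xy: "(x, y) \<in> \<theta>" "x \<noteq> y" for x y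
  proof (rule ccontr)
    assume "x \<notin> A"
    have xyH: "x \<in> H" "y \<in> H" using congs_sub[OF \<theta> xy(1)] by blast+
    have "x \<noteq> z" "y \<noteq> z" "x \<noteq> e" "y \<noteq> e"
      using xy iso congs_sym[OF \<theta> xy(1)] by blast+
    then have "hm x x = x" "hm y x = z"
      using xy \<open>x \<notin> A\<close> xyH by auto
    then have "(x, z) \<in> \<theta>" using congs_m[OF \<theta> xy(1) xyH(1)] by simp
    then show False using iso(1) congs_sym[OF \<theta>] \<open>x \<noteq> z\<close> by blast
  qed
  have "\<theta> \<inter> A \<times> A \<in> congs A j m"
    by (rule congs_restrict[OF \<theta>]) auto
  moreover have "\<theta> = \<theta> \<inter> A \<times> A \<union> Id_on H"
  proof (rule rel_eqI)
    show "(x, y) \<in> \<theta> \<longleftrightarrow> (x, y) \<in> \<theta> \<inter> A \<times> A \<union> Id_on H" for x y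
      using mem_A[of x y] mem_A[of y x] congs_sym[OF \<theta>, of x y] congs_sub[OF \<theta>, of x y]
        congs_refl[OF \<theta>, of x] by auto
  qed
  ultimately show "\<theta> \<in> (\<lambda>\<alpha>. \<alpha> \<union> Id_on H) ` congs A j m" by blast
next
  fix \<theta> assume "\<theta> \<in> (\<lambda>\<alpha>. \<alpha> \<union> Id_on H) ` congs A j m"
  then obtain \<alpha> where \<alpha>: "\<alpha> \<in> congs A j m" and \<theta>: "\<theta> = \<alpha> \<union> Id_on H" by blast
  have "(z, x) \<notin> \<alpha>" "(x, e) \<notin> \<alpha>" for x
    using congs_sub[OF \<alpha>] z_new e_new by blast+
  then show "\<theta> \<in> bounds_isolated"
    unfolding bounds_isolated_def using cong_extend[OF \<alpha>] \<theta> by auto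
qed

lemma card_bounds_isolated: "card bounds_isolated = card (congs A j m)"
  unfolding bounds_isolated_eq
proof (rule card_image, rule inj_onI)
  fix \<alpha> \<beta> assume ab: "\<alpha> \<in> congs A j m" "\<beta> \<in> congs A j m" "\<alpha> \<union> Id_on H = \<beta> \<union> Id_on H"
  have "\<gamma> = (\<gamma> \<union> Id_on H) \<inter> A \<times> A" if "\<gamma> \<in> congs A j m" for \<gamma>
    by (auto dest: congs_sub[OF that] intro: congs_refl[OF that])
  then show "\<alpha> = \<beta>" using ab by metis
qed

lemma bounds_collapsed:
  assumes \<theta>: "\<theta> \<in> congs H hj hm" and "(z, e) \<in> \<theta>"
  shows "\<theta> = H \<times> H"
proof -
  have z: "(z, x) \<in> \<theta>" if "x \<in> H" for x
    using congs_m[OF assms that] by simp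
  have "(x, y) \<in> \<theta>" if "x \<in> H" "y \<in> H" for x y
    by (rule congs_trans[OF \<theta> congs_sym[OF \<theta> z[OF that(1)]] z[OF that(2)]])
  then show ?thesis
    using congs_subset[OF \<theta>] by (intro equalityI subrelI) blast+
qed

lemma full_cong: "H \<times> H \<in> congs H hj hm"
proof -
  interpret H: bounded_lattice_ops H hj hm z e by (rule bounded)
  show ?thesis by (rule congs_full[OF H.j_closed H.m_closed])
qed

lemma full_not_isolated: "H \<times> H \<notin> bounds_isolated"
  unfolding bounds_isolated_def using ze by auto

text \<open>
  The argument for the simplicity of \<open>M\<^sub>3\<close>: if the bottom is congruent to some \<open>x\<close>, then joining
  with any \<open>y\<close> that is a complement of \<open>x\<close> makes \<open>y\<close> congruent to the top. As the middle has at
  least three summands, there are two such \<open>y\<close> in different summands; their meet, the bottom, is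
  then congruent to the top.
\<close>

lemma bottom_isolated:
  assumes \<theta>: "\<theta> \<in> congs H hj hm" and "(z, e) \<notin> \<theta>"
    and c: "c \<in> C" "c' \<in> C" "c \<noteq> c'" and x: "(z, x) \<in> \<theta>"
  shows "x = z"
proof (rule ccontr)
  assume "x \<noteq> z"
  have xH: "x \<in> H" "x \<noteq> e" using congs_sub[OF \<theta> x] x assms(2) by auto
  have top: "(y, e) \<in> \<theta>" if "y \<in> A \<union> C" "y \<noteq> x" "\<not> (x \<in> A \<and> y \<in> A)" for y
  proof -
    have "hj z y = y" "hj x y = e"
      using that xH \<open>x \<noteq> z\<close> by auto
    then show ?thesis using congs_j[OF \<theta> x, of y] that by auto
  qed
  \<comment> \<open>the summands of the middle are \<open>A\<close> and the singletons of \<open>C\<close>; choose two that avoid \<open>x\<close>\<close>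
  obtain p q where "p \<in> C" "q \<in> A \<union> C" "p \<noteq> q" "(p, e) \<in> \<theta>" "(q, e) \<in> \<theta>"
  proof (cases "x \<in> A")
    case True
    then show ?thesis using that[of c c'] top c disj by blast
  next
    case False
    obtain a where "a \<in> A" using A_ne by blast
    then show ?thesis
      using that[of c a] that[of c' a] top[of a] top[of c] top[of c'] c disj False by (cases "x = c") auto
  qed
  then have "(hm q p, hm e p) \<in> \<theta>" "hm q p = z" "hm e p = p"
    using congs_m[OF \<theta>, of q e p] by auto
  then show False
    using congs_trans[OF \<theta>, of z p e] \<open>(p, e) \<in> \<theta>\<close> assms(2) by simp
qed

lemma congs_many:
  assumes c: "c \<in> C" "c' \<in> C" "c \<noteq> c'"
  shows "congs H hj hm = insert (H \<times> H) bounds_isolated"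
proof (intro equalityI subsetI)
  fix \<theta> assume \<theta>: "\<theta> \<in> congs H hj hm"
  interpret d: horizontal A m j C e z by (rule horizontal_dual)
  have H: "d.H = H" by blast
  have \<theta>': "\<theta> \<in> congs d.H d.hj d.hm" using \<theta> congs_dual unfolding H by blast
  show "\<theta> \<in> insert (H \<times> H) bounds_isolated"
  proof (cases "(z, e) \<in> \<theta>")
    case True then show ?thesis using bounds_collapsed[OF \<theta>] by blast
  next
    case False
    then have "(e, z) \<notin> \<theta>" using congs_sym[OF \<theta>] by blast
    then have "x = e" if "(x, e) \<in> \<theta>" for x
      using d.bottom_isolated[OF \<theta>' _ c congs_sym[OF \<theta> that]] by blast
    then show ?thesis
      unfolding bounds_isolated_def using \<theta> bottom_isolated[OF \<theta> False c] by blast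
  qed
qed (use full_cong bounds_isolated_def in auto)

text \<open>
  With a single additional element \<open>c\<close> there are two congruences with exactly two classes: \<open>A\<close>
  goes either with the bottom, as here, or dually with the top.
\<close>

definition "split_at_bottom c = insert z A \<times> insert z A \<union> {c, e} \<times> {c, e}"

lemma split_at_bottom_cong:
  assumes C: "C = {c}"
  shows "split_at_bottom c \<in> congs H hj hm"
proof (rule congsI)
  have c: "c \<in> C" "c \<noteq> z" "c \<noteq> e" "c \<notin> A" using C z_new e_new disj by auto
  have H: "H = insert z (insert e (insert c A))" unfolding C by blast
  show "split_at_bottom c \<subseteq> H \<times> H"
    unfolding split_at_bottom_def C by blast
  show "(x, x) \<in> split_at_bottom c" if "x \<in> H" for x
    using that unfolding split_at_bottom_def C by blast
  show "(y, x) \<in> split_at_bottom c" if "(x, y) \<in> split_at_bottom c" for x y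
    using that unfolding split_at_bottom_def by blast
  show "(x, v) \<in> split_at_bottom c" if "(x, y) \<in> split_at_bottom c" "(y, v) \<in> split_at_bottom c" for x y v
    using that c z_new e_new ze unfolding split_at_bottom_def by (elim UnE SigmaE2 insertE emptyE) auto
  fix x y u assume xy: "(x, y) \<in> split_at_bottom c" and u: "u \<in> H"
  show "(hj x u, hj y u) \<in> split_at_bottom c" "(hm x u, hm y u) \<in> split_at_bottom c"
    using xy u unfolding H split_at_bottom_def
    by (elim UnE SigmaE2 insertE emptyE; simp add: c)+
qed

text \<open>
  One collapsed pair already determines the congruence: meeting \<open>c \<equiv> e\<close> with the elements of \<open>A\<close>
  collapses them with the bottom, and any further pair would connect the bottom with the top.
\<close>

lemma eq_split_at_bottom:
  assumes C: "C = {c}" and \<theta>: "\<theta> \<in> congs H hj hm" and "(z, e) \<notin> \<theta>" and ce: "(c, e) \<in> \<theta>"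
  shows "\<theta> = split_at_bottom c"
proof -
  have z: "(z, x) \<in> \<theta>" if "x \<in> insert z A" for x
    using congs_m[OF \<theta> ce, of x] congs_refl[OF \<theta>] that C by auto
  have e: "(x, e) \<in> \<theta>" if "x \<in> {c, e}" for x
    using that ce congs_refl[OF \<theta>, of e] by auto
  have sub: "split_at_bottom c \<subseteq> \<theta>"
    unfolding split_at_bottom_def
    using congs_trans[OF \<theta> congs_sym[OF \<theta> z] z] congs_trans[OF \<theta> e congs_sym[OF \<theta> e]]
    by (intro subrelI) blast
  have cross: "(x, y) \<notin> \<theta>" if "x \<in> insert z A" "y \<in> {c, e}" for x y
    using z[OF that(1)] e[OF that(2)] assms(3) congs_trans[OF \<theta>, of z x y] congs_trans[OF \<theta>, of z y e]
    by blast
  have "(x, y) \<in> split_at_bottom c" if "(x, y) \<in> \<theta>" for x y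
  proof -
    have "x \<in> insert z A \<or> x \<in> {c, e}" "y \<in> insert z A \<or> y \<in> {c, e}"
      using congs_sub[OF \<theta> that] unfolding C by blast+
    then show ?thesis
      using cross[of x y] cross[of y x] that congs_sym[OF \<theta> that]
      unfolding split_at_bottom_def by (elim disjE) blast+
  qed
  then show ?thesis using sub by (intro equalityI subrelI) blast+
qed

lemma bottom_not_isolated:
  assumes C: "C = {c}" and \<theta>: "\<theta> \<in> congs H hj hm" and "(z, e) \<notin> \<theta>" and x: "(z, x) \<in> \<theta>" "x \<noteq> z"
  shows "(c, e) \<in> \<theta> \<or> (c, z) \<in> \<theta>"
proof (cases "x = c")
  case False
  then have "x \<in> A" using congs_sub[OF \<theta> x(1)] C x assms(3) by blast
  then show ?thesis
    using congs_j[OF \<theta> x(1), of c] C by auto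
qed (use x congs_sym[OF \<theta>] in blast)

lemma congs_one:
  assumes C: "C = {c}"
  shows "congs H hj hm = bounds_isolated \<union>
    {H \<times> H, split_at_bottom c, insert e A \<times> insert e A \<union> {c, z} \<times> {c, z}}"
proof -
  interpret d: horizontal A m j C e z by (rule horizontal_dual)
  have H: "d.H = H" by blast
  have dual: "congs d.H d.hj d.hm = congs H hj hm" using congs_dual unfolding H by blast
  have top: "d.split_at_bottom c = insert e A \<times> insert e A \<union> {c, z} \<times> {c, z}"
    unfolding d.split_at_bottom_def ..
  have cases: "\<theta> \<in> bounds_isolated \<union> {H \<times> H, split_at_bottom c, d.split_at_bottom c}"
    if \<theta>: "\<theta> \<in> congs H hj hm" for \<theta>
  proof (cases "(z, e) \<in> \<theta>")
    case True then show ?thesis using bounds_collapsed[OF \<theta>] by simp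
  next
    case False
    then have False': "(e, z) \<notin> \<theta>" using congs_sym[OF \<theta>] by blast
    have \<theta>': "\<theta> \<in> congs d.H d.hj d.hm" using \<theta> dual by blast
    show ?thesis
    proof (cases "(c, e) \<in> \<theta> \<or> (c, z) \<in> \<theta>")
      case True
      then show ?thesis
        using eq_split_at_bottom[OF C \<theta> False] d.eq_split_at_bottom[OF C \<theta>' False'] by (elim disjE) simp_all
    next
      case no: False
      then have "x = z" if "(z, x) \<in> \<theta>" for x
        using bottom_not_isolated[OF C \<theta> False that] by blast
      moreover have "x = e" if "(x, e) \<in> \<theta>" for x
        using no d.bottom_not_isolated[OF C \<theta>' False' congs_sym[OF \<theta> that]] by blast
      ultimately show ?thesis
        unfolding bounds_isolated_def using \<theta> by blast
    qed
  qed
  show ?thesis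
  proof (rule equalityI)
    show "congs H hj hm \<subseteq> bounds_isolated \<union>
        {H \<times> H, split_at_bottom c, insert e A \<times> insert e A \<union> {c, z} \<times> {c, z}}"
      using cases unfolding top by (rule subsetI)
    have "bounds_isolated \<subseteq> congs H hj hm" unfolding bounds_isolated_def by (rule Collect_restrict)
    then show "bounds_isolated \<union>
        {H \<times> H, split_at_bottom c, insert e A \<times> insert e A \<union> {c, z} \<times> {c, z}} \<subseteq> congs H hj hm"
      by (intro Un_least insert_subsetI empty_subsetI full_cong split_at_bottom_cong[OF C]
          d.split_at_bottom_cong[OF C, unfolded dual top])
  qed
qed

lemma card_H: "finite A \<Longrightarrow> finite C \<Longrightarrow> card H = card A + card C + 2"
  using z_new e_new ze disj by (simp add: card_Un_disjoint)

lemma card_congs_many: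
  assumes "finite A" and "c \<in> C" "c' \<in> C" "c \<noteq> c'"
  shows "card (congs H hj hm) = card (congs A j m) + 1"
proof -
  have "finite bounds_isolated"
    unfolding bounds_isolated_eq using finite_congs[OF assms(1)] by blast
  then show ?thesis
    unfolding congs_many[OF assms(2-)]
    by (simp only: card_insert_disjoint[OF _ full_not_isolated] card_bounds_isolated Suc_eq_plus1)
qed

lemma card_congs_one:
  assumes "finite A" and C: "C = {c}"
  shows "card (congs H hj hm) = card (congs A j m) + 3"
proof -
  let ?K = "split_at_bottom c" and ?K' = "insert e A \<times> insert e A \<union> {c, z} \<times> {c, z}"
  obtain a where a: "a \<in> A" using A_ne by blast
  have c: "c \<notin> A" "c \<noteq> e" "c \<noteq> z" using C disj z_new e_new by auto
  have "finite bounds_isolated"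
    unfolding bounds_isolated_eq using finite_congs[OF assms(1)] by blast
  moreover have "?K \<notin> bounds_isolated"
    unfolding bounds_isolated_def split_at_bottom_def using a z_new by blast
  moreover have "?K' \<notin> bounds_isolated"
    unfolding bounds_isolated_def using a e_new by blast
  moreover have "(z, e) \<notin> ?K" "(z, e) \<notin> ?K'" "(c, e) \<in> ?K" "(c, e) \<notin> ?K'"
    unfolding split_at_bottom_def using c z_new e_new ze by auto
  moreover from this have "?K \<noteq> ?K'" "?K \<noteq> H \<times> H" "?K' \<noteq> H \<times> H" by blast+
  moreover have "card (S \<union> {p, q, r}) = card S + 3"
    if "finite S" "p \<notin> S" "q \<notin> S" "r \<notin> S" "q \<noteq> r" "q \<noteq> p" "r \<noteq> p" for S :: "'b set" and p q r
    using that by simp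
  ultimately show ?thesis
    unfolding congs_one[OF C] card_bounds_isolated[symmetric] using full_not_isolated by metis
qed

end

section \<open>The two smallest lattices\<close>

text \<open>
  On the two elements \<open>a\<close> and \<open>b\<close> this is the join if \<open>a\<close> is the top, and the meet if \<open>a\<close> is the
  bottom.
\<close>

definition absorbing :: "'a \<Rightarrow> 'a \<Rightarrow> 'a \<Rightarrow> 'a \<Rightarrow> 'a" where
  "absorbing a b x y = (if x = a \<or> y = a then a else b)"

lemma two_chain:
  assumes "p \<noteq> q"
  shows "bounded_lattice_ops {p, q} (absorbing q p) (absorbing p q) p q"
  by unfold_locales (use assms in \<open>auto simp: absorbing_def\<close>)

lemma congs_two_chain:
  assumes "p \<noteq> q"
  shows "congs {p, q} (absorbing q p) (absorbing p q) = {Id_on {p, q}, {p, q} \<times> {p, q}}"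
proof (intro equalityI subsetI)
  fix \<theta> assume \<theta>: "\<theta> \<in> congs {p, q} (absorbing q p) (absorbing p q)"
  have r: "(p, p) \<in> \<theta>" "(q, q) \<in> \<theta>" using congs_refl[OF \<theta>] by blast+
  show "\<theta> \<in> {Id_on {p, q}, {p, q} \<times> {p, q}}"
  proof (cases "(p, q) \<in> \<theta>")
    case True
    then have "\<theta> = {p, q} \<times> {p, q}"
      using r congs_sym[OF \<theta> True] congs_subset[OF \<theta>] by (intro equalityI) auto
    then show ?thesis by blast
  next
    case False
    then have "(q, p) \<notin> \<theta>" using congs_sym[OF \<theta>] by blast
    then have "\<theta> = Id_on {p, q}"
      using False r congs_subset[OF \<theta>] by (intro equalityI) auto
    then show ?thesis by blast
  qed
next
  fix \<theta> assume "\<theta> \<in> {Id_on {p, q}, {p, q} \<times> {p, q}}"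
  then show "\<theta> \<in> congs {p, q} (absorbing q p) (absorbing p q)"
    by (intro congsI) (auto simp: absorbing_def)
qed

lemma card_congs_two_chain:
  "p \<noteq> q \<Longrightarrow> card (congs {p, q} (absorbing q p) (absorbing p q)) = 2"
proof -
  assume "p \<noteq> q"
  moreover from this have "Id_on {p, q} \<noteq> {p, q} \<times> {p, q}" by auto
  ultimately show ?thesis unfolding congs_two_chain[OF \<open>p \<noteq> q\<close>] card_2_iff by blast
qed

lemma singleton_lattice:
  obtains j m where "bounded_lattice_ops {c} j m c c" "card (congs {c} j m) = 1"
proof -
  define f :: "'a \<Rightarrow> 'a \<Rightarrow> 'a" where "f = (\<lambda>x y. c)"
  have "bounded_lattice_ops {c} f f c c"
    by unfold_locales (auto simp: f_def)
  moreover have "congs {c} f f = {{(c, c)}}"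
  proof (intro equalityI subsetI)
    fix \<theta> assume \<theta>: "\<theta> \<in> congs {c} f f"
    then show "\<theta> \<in> {{(c, c)}}"
      using congs_subset[OF \<theta>] congs_refl[OF \<theta>] by auto
  qed (auto simp: f_def intro!: congsI)
  ultimately show thesis using that[of f f] by simp
qed

section \<open>Realizable pairs of sizes and congruence numbers\<close>

text \<open>
  The elements are natural numbers, so that there are always fresh ones for the next construction.
\<close>

definition realizable :: "nat \<Rightarrow> nat \<Rightarrow> bool" where
  "realizable n k \<longleftrightarrow> (\<exists>(A :: nat set) j m b t. bounded_lattice_ops A j m b t \<and>
     finite A \<and> card A = n \<and> card (congs A j m) = k)"

lemma realizable_singleton: "realizable 1 1"
proof -
  obtain j m :: "nat \<Rightarrow> nat \<Rightarrow> nat" where "bounded_lattice_ops {0} j m 0 0" "card (congs {0} j m) = 1"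
    by (rule singleton_lattice)
  moreover have "finite {0 :: nat}" "card {0 :: nat} = 1" by simp_all
  ultimately show ?thesis unfolding realizable_def by blast
qed

lemma fresh:
  assumes "finite (A :: nat set)"
  obtains C where "finite C" "card C = r" "A \<inter> C = {}"
  using infinite_arbitrarily_large[of "- A" r] assms by (metis disjoint_eq_subset_Compl finite_compl infinite_UNIV_nat Int_commute)

lemma fresh_element:
  assumes "finite (A :: nat set)"
  obtains x where "x \<notin> A"
  using ex_new_if_finite[OF infinite_UNIV_nat assms] by blast

lemma realizable_horizontal:
  assumes "realizable n k" "r \<ge> 1"
  shows "realizable (n + r + 2) (if r = 1 then k + 3 else k + 1)"
proof -
  obtain A :: "nat set" and j m b t where A: "bounded_lattice_ops A j m b t"
    "finite A" "card A = n" "card (congs A j m) = k"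
    using assms(1) unfolding realizable_def by blast
  interpret bounded_lattice_ops A j m b t by fact
  obtain z where z: "z \<notin> A" using fresh_element[OF A(2)] by blast
  obtain e where e: "e \<notin> insert z A" using fresh_element[of "insert z A"] A(2) by blast
  obtain C where C: "finite C" "card C = r" "insert e (insert z A) \<inter> C = {}"
    using fresh[of "insert e (insert z A)" r] A(2) by blast
  have "C \<noteq> {}" using C(2) assms(2) by auto
  interpret horizontal A j m C z e
    by unfold_locales (use z e C(3) \<open>C \<noteq> {}\<close> b_in in blast)+
  have "card (congs H hj hm) = (if r = 1 then k + 3 else k + 1)"
  proof (cases "r = 1")
    case True
    then obtain c where "C = {c}" using C(2) card_1_singletonE by metis
    then show ?thesis using card_congs_one[OF A(2)] A(4) True by simp
  next
    case False
    then have "\<not> card C \<le> 1" using C(2) assms(2) by simp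
    then obtain c c' where "c \<in> C" "c' \<in> C" "c \<noteq> c'"
      using C(1) by (metis card_le_Suc0_iff_eq One_nat_def)
    then show ?thesis using card_congs_many[OF A(2)] A(4) False by simp
  qed
  then show ?thesis
    unfolding realizable_def using bounded card_H[OF A(2) C(1)] A C by (metis finite_Un finite_insert)
qed

lemma realizable_add_two_atoms:
  "realizable n k \<Longrightarrow> realizable (n + 3) (k + 3)"
  using realizable_horizontal[of n k 1] by (simp add: numeral_eq_Suc)

text \<open>
  The second lattice is chosen after the first one, with the top of the first one as its
  bottom and otherwise fresh elements; so no isomorphic copies have to be formed.
\<close>

lemma realizable_glue:
  assumes "realizable n k"
    and B: "\<And>A p. finite (A :: nat set) \<Longrightarrow> p \<in> A \<Longrightarrow>
      \<exists>B j m t. A \<inter> B = {p} \<and> bounded_lattice_ops B j m p t \<and> finite B \<and> card B = Suc n' \<and>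
        card (congs B j m) = k'"
  shows "realizable (n + n') (k * k')"
proof -
  obtain A :: "nat set" and jA mA b p where A: "bounded_lattice_ops A jA mA b p"
    "finite A" "card A = n" "card (congs A jA mA) = k"
    using assms(1) unfolding realizable_def by blast
  interpret bounded_lattice_ops A jA mA b p by fact
  obtain B jB mB t where B: "A \<inter> B = {p}" "bounded_lattice_ops B jB mB p t" "finite B"
      "card B = Suc n'" "card (congs B jB mB) = k'"
    using B[OF A(2) t_in] by blast
  interpret glued_sum A jA mA b p B jB mB t
    using A(1) B(1,2) by (simp add: glued_sum_def glued_sum_axioms_def)
  have "card (congs (A \<union> B) j m) = k * k'"
    using bij_betw_same_card[OF bij_congs] A(4) B(5) by (simp add: card_cartesian_product)
  moreover have "card (A \<union> B) = n + n'"
    using card_Un_Int[OF A(2) B(3)] A(3) B(4) B(1) by simp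
  ultimately show ?thesis
    unfolding realizable_def using bounded A(2) B(3) by blast
qed

lemma realizable_double:
  assumes "realizable n k"
  shows "realizable (n + 1) (2 * k)"
proof -
  have "\<exists>B j m t. A \<inter> B = {p} \<and> bounded_lattice_ops B j m p t \<and> finite B \<and> card B = Suc 1 \<and>
      card (congs B j m) = 2" if A: "finite A" "p \<in> A" for A :: "nat set" and p
  proof -
    obtain q where q: "q \<notin> A" using fresh_element[OF A(1)] .
    then have "p \<noteq> q" using A(2) by blast
    then have "A \<inter> {p, q} = {p}" "finite {p, q}" "card {p, q} = Suc 1" using A(2) q by auto
    then show ?thesis
      using two_chain[OF \<open>p \<noteq> q\<close>] card_congs_two_chain[OF \<open>p \<noteq> q\<close>] by blast
  qed
  from realizable_glue[OF assms this] show ?thesis by (simp add: mult.commute)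
qed

text \<open>
  The four-element Boolean lattice is the horizontal extension of a one-element lattice by a single
  element, which accounts for its \<open>1 + 3\<close> congruences.
\<close>

lemma realizable_quadruple:
  assumes "realizable n k"
  shows "realizable (n + 3) (4 * k)"
proof -
  have "\<exists>B j m t. A \<inter> B = {p} \<and> bounded_lattice_ops B j m p t \<and> finite B \<and> card B = Suc 3 \<and>
      card (congs B j m) = 4" if A: "finite A" "p \<in> A" for A :: "nat set" and p
  proof -
    obtain c where c: "c \<notin> A" using fresh_element[OF A(1)] .
    obtain d where d: "d \<notin> insert c A" using fresh_element[of "insert c A"] A(1) by blast
    obtain q where q: "q \<notin> insert d (insert c A)"
      using fresh_element[of "insert d (insert c A)"] A(1) by blast
    have distinct: "p \<noteq> c" "p \<noteq> d" "p \<noteq> q" "c \<noteq> d" "c \<noteq> q" "d \<noteq> q" using A(2) c d q by blast+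
    obtain j1 m1 where single: "bounded_lattice_ops {c} j1 m1 c c" "card (congs {c} j1 m1) = 1"
      by (rule singleton_lattice)
    interpret bounded_lattice_ops "{c}" j1 m1 c c by (rule single)
    interpret horizontal "{c}" j1 m1 "{d}" p q
      by unfold_locales (use distinct in simp_all)
    have "A \<inter> H = {p}" using A(2) c d q by auto
    moreover have "card H = Suc 3" using card_H by simp
    moreover have "card (congs H hj hm) = 4"
      using card_congs_one[of d] single(2) by simp
    moreover have "finite H" by simp
    ultimately show ?thesis using bounded by blast
  qed
  from realizable_glue[OF assms this] show ?thesis by (simp add: mult.commute)
qed

lemma realizable_add_atoms:
  assumes "realizable n k" "r \<ge> 2"
  shows "realizable (n + r + 2) (k + 1)"
  using realizable_horizontal[OF assms(1), of r] assms(2) by simp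

lemma realizable_chain: "realizable (Suc i) (2 ^ i)"
proof (induction i)
  case (Suc i)
  then show ?case using realizable_double by fastforce
qed (use realizable_singleton in simp)

lemma realizable_double_iterate: "realizable n k \<Longrightarrow> realizable (n + i) (2 ^ i * k)"
proof (induction i)
  case (Suc i)
  then show ?case using realizable_double[of "n + i" "2 ^ i * k"] by (simp add: mult.assoc)
qed simp

text \<open>These are the diamonds with \<open>n - 2\<close> atoms, which are simple for \<open>n \<ge> 5\<close>.\<close>

lemma realizable_two:
  assumes "n \<ge> 5"
  shows "realizable n 2"
proof -
  have "1 + (n - 3) + 2 = n" "2 \<le> n - 3" using assms by simp_all
  then show ?thesis using realizable_add_atoms[OF realizable_singleton, of "n - 3"] by (simp only: one_add_one)
qed

text \<open>A chain of \<open>i + 1\<close> elements, horizontally extended by the remaining \<open>n - i - 3 \<ge> 2\<close> elements.\<close>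

lemma realizable_succ_power:
  assumes "n \<ge> i + 5"
  shows "realizable n (2 ^ i + 1)"
proof -
  have "Suc i + (n - i - 3) + 2 = n" "2 \<le> n - i - 3" using assms by simp_all
  then show ?thesis using realizable_add_atoms[OF realizable_chain, of "n - i - 3" i] by (simp only:)
qed

lemma realizable_four_four: "realizable 4 4"
  using realizable_add_two_atoms[OF realizable_singleton] by simp

lemma realizable_power_two:
  assumes "n \<ge> 7" "1 \<le> i" "i \<le> n - 1"
  shows "realizable n (2 ^ i)"
proof -
  consider "i = n - 1" | "i = n - 2" | "i = n - 3" | "i \<le> n - 4" using assms by linarith
  then show ?thesis
  proof cases
    case 1
    then show ?thesis using realizable_chain[of i] assms by simp
  next
    case 2
    then have eqs: "4 + (n - 4) = n" "n - 4 + 2 = i" using assms(1) by simp_all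
    have "2 ^ (n - 4) * 4 = (2::nat) ^ i" unfolding eqs(2)[symmetric] power_add by simp
    with eqs(1) show ?thesis
      using realizable_double_iterate[OF realizable_four_four, of "n - 4"] by (simp only:)
  next
    \<comment> \<open>two Boolean squares, one on top of the other, have \<open>7\<close> elements and \<open>16\<close> congruences\<close>
    case 3
    then have eqs: "4 + 3 + (n - 7) = n" "n - 7 + 4 = i" using assms(1) by simp_all
    have "2 ^ (n - 7) * (4 * 4) = (2::nat) ^ i" unfolding eqs(2)[symmetric] power_add by simp
    with eqs(1) show ?thesis
      using realizable_double_iterate[OF realizable_quadruple[OF realizable_four_four], of "n - 7"]
      by (simp only:)
  next
    case 4
    then have eqs: "n - i + 1 + (i - 1) = n" "n - i + 1 \<ge> 5" "i - 1 + 1 = i" using assms by simp_all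
    have "2 ^ (i - 1) * 2 = (2::nat) ^ i" by (subst (2) eqs(3)[symmetric]) (simp add: power_add)
    with eqs(1,2) show ?thesis
      using realizable_double_iterate[OF realizable_two, of "n - i + 1" "i - 1"] by (simp only:)
  qed
qed

text \<open>
  Doubling leads from size \<open>8\<close> to size \<open>9\<close>, so size \<open>8\<close> is included here, with the exception of
  a single number.
\<close>

lemma realizable_small:
  assumes "n \<ge> 7" "2 \<le> k" "k \<le> n + 1" "(n, k) \<noteq> (8, 7)"
  shows "realizable n k"
  using assms
proof (induction n arbitrary: k rule: less_induct)
  case (less n)
  have base: "k = 2 \<or> k = 3 \<or> k = 5 \<Longrightarrow> ?case" "k = 9 \<Longrightarrow> n \<ge> 8 \<Longrightarrow> ?case"
    using realizable_two[of n] realizable_succ_power[of 1 n] realizable_succ_power[of 2 n]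
      realizable_succ_power[of 3 n] less.prems(1) by auto
  \<comment> \<open>a two-element chain on top of a simple lattice\<close>
  have four: "realizable i 4" if "i \<ge> 6" for i
    using realizable_double[OF realizable_two, of "i - 1"] that by simp
  have double: "?case" if "realizable (n - 1) (k div 2)" "even k"
    using realizable_double[OF that(1)] that(2) less.prems(1) by simp
  have add3: "?case" if "realizable (n - 3) (k - 3)" "k \<ge> 3"
    using realizable_add_two_atoms[OF that(1)] that(2) less.prems(1) by simp
  have not_8_7: "\<not> (n = 8 \<and> k = 7)" using less.prems(4) by simp
  have "k = 2 \<or> k = 3 \<or> k = 5 \<or> k = 9 \<and> n \<ge> 8 \<or> n = 7 \<and> (k = 4 \<or> k = 6 \<or> k = 8) \<or>
      n = 7 \<and> k = 7 \<or> n = 9 \<and> k = 7 \<or> n \<ge> 8 \<and> even k \<and> k \<ge> 4 \<or> n \<ge> 10 \<and> odd k \<and> k \<ge> 7"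
    using less.prems(1-3) not_8_7 by presburger
  then consider "k = 2 \<or> k = 3 \<or> k = 5" | "k = 9" "n \<ge> 8" | "n = 7" "k = 4 \<or> k = 6 \<or> k = 8"
    | "n = 7" "k = 7" | "n = 9" "k = 7" | "n \<ge> 8" "even k" "k \<ge> 4" | "n \<ge> 10" "odd k" "k \<ge> 7"
    by blast
  then show ?case
  proof cases
    case 3
    then show ?thesis
      using double four[of 6] realizable_two[of 6] realizable_succ_power[of 1 6] by auto
  next
    case 4
    then show ?thesis using add3 realizable_four_four by simp
  next
    case 5
    then show ?thesis using add3 four[of 6] by simp
  next
    case 6
    then have "realizable (n - 1) (k div 2)"
      using less.prems by (intro less.IH) auto
    then show ?thesis using double 6 by blast
  next
    case 7
    \<comment> \<open>so that the pair \<open>(8, 7)\<close> is avoided for \<open>n = 11\<close>\<close>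
    have "k \<noteq> 10" using 7(2) by auto
    then have "realizable (n - 3) (k - 3)"
      using less.prems 7 by (intro less.IH) auto
    then show ?thesis using add3 7 by simp
  qed (use base in blast)+
qed

section \<open>Passage to ordered lattices\<close>

context lattice_ops
begin

definition "as_gorder = \<lparr>carrier = A, eq = (=), le = (\<lambda>x y. m x y = x)\<rparr>"

lemma as_gorder_simps [simp]:
  "carrier as_gorder = A" "eq as_gorder = (=)" "x \<sqsubseteq>\<^bsub>as_gorder\<^esub> y \<longleftrightarrow> m x y = x"
  by (simp_all add: as_gorder_def)

lemma partial_order: "partial_order as_gorder"
proof -
  have antisym: "x = y" if "m x y = x" "m y x = y" "x \<in> A" "y \<in> A" for x y
    using that m_comm[of x y] by simp
  have trans: "m x z = x" if "m x y = x" "m y z = y" "x \<in> A" "y \<in> A" "z \<in> A" for x y z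
    using that m_assoc[of x y z] by simp
  show ?thesis
    by (unfold_locales; simp only: as_gorder_simps m_idem; (rule antisym trans; assumption)?)
qed

lemma least_join:
  assumes "x \<in> A" "y \<in> A"
  shows "least as_gorder (j x y) (Upper as_gorder {x, y})"
proof -
  have "m (j x y) z = j x y" if "z \<in> A" "m x z = x" "m y z = y" for z
    using that assms by (metis m_eq_iff j_assoc j_closed)
  moreover have "m y (j x y) = y" using assms by (metis j_comm m_absorb)
  ultimately show ?thesis using assms by (auto simp: least_def Upper_def)
qed

lemma greatest_meet:
  assumes "x \<in> A" "y \<in> A"
  shows "greatest as_gorder (m x y) (Lower as_gorder {x, y})"
proof -
  have "m z (m x y) = z" if "z \<in> A" "m z x = z" "m z y = z" for z
    using that assms by (metis m_assoc)
  moreover have "m (m x y) x = m x y" "m (m x y) y = m x y"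
    using assms by (metis m_assoc m_comm m_idem)+
  ultimately show ?thesis using assms by (auto simp: greatest_def Lower_def)
qed

lemma lattice: "lattice as_gorder"
proof -
  interpret partial_order as_gorder by (rule partial_order)
  show ?thesis
    by unfold_locales (auto intro: least_join greatest_meet)
qed

lemma join_as_gorder:
  assumes "x \<in> A" "y \<in> A"
  shows "x \<squnion>\<^bsub>as_gorder\<^esub> y = j x y"
proof -
  interpret L: lattice as_gorder by (rule lattice)
  have "least as_gorder (x \<squnion>\<^bsub>as_gorder\<^esub> y) (Upper as_gorder {x, y})"
    by (rule L.joinI[where P = "\<lambda>s. least as_gorder s (Upper as_gorder {x, y})"])
      (simp_all only: assms as_gorder_simps)
  then show ?thesis by (rule L.least_unique[OF _ least_join[OF assms]])
qed

lemma meet_as_gorder: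
  assumes "x \<in> A" "y \<in> A"
  shows "x \<sqinter>\<^bsub>as_gorder\<^esub> y = m x y"
proof -
  interpret L: lattice as_gorder by (rule lattice)
  have "greatest as_gorder (x \<sqinter>\<^bsub>as_gorder\<^esub> y) (Lower as_gorder {x, y})"
    by (rule L.meetI[where P = "\<lambda>s. greatest as_gorder s (Lower as_gorder {x, y})"])
      (simp_all only: assms as_gorder_simps)
  then show ?thesis by (rule L.greatest_unique[OF _ greatest_meet[OF assms]])
qed

lemma Con_lat_as_gorder: "Con_lat as_gorder = congs A j m"
proof (intro equalityI subsetI)
  fix \<theta> assume \<theta>: "\<theta> \<in> congs A j m"
  have "(a \<squnion>\<^bsub>as_gorder\<^esub> c, b \<squnion>\<^bsub>as_gorder\<^esub> d) \<in> \<theta> \<and> (a \<sqinter>\<^bsub>as_gorder\<^esub> c, b \<sqinter>\<^bsub>as_gorder\<^esub> d) \<in> \<theta>"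
    if ab: "(a, b) \<in> \<theta>" and cd: "(c, d) \<in> \<theta>" for a b c d
  proof -
    have in_A: "a \<in> A" "b \<in> A" "c \<in> A" "d \<in> A"
      using congs_sub[OF \<theta> ab] congs_sub[OF \<theta> cd] by simp_all
    have "(j a c, j b c) \<in> \<theta>" "(j b c, j b d) \<in> \<theta>" "(m a c, m b c) \<in> \<theta>" "(m b c, m b d) \<in> \<theta>"
      using congs_j[OF \<theta> ab in_A(3)] congs_j[OF \<theta> cd in_A(2)] congs_m[OF \<theta> ab in_A(3)]
        congs_m[OF \<theta> cd in_A(2)] in_A by (simp_all add: j_comm m_comm)
    then show ?thesis
      using congs_trans[OF \<theta>, of "j a c" "j b c"] congs_trans[OF \<theta>, of "m a c" "m b c"] in_A
      by (simp add: join_as_gorder meet_as_gorder)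
  qed
  then show "\<theta> \<in> Con_lat as_gorder"
    using \<theta> unfolding Con_lat_def congs_def by simp
next
  fix \<theta> assume \<theta>: "\<theta> \<in> Con_lat as_gorder"
  then have equiv: "equiv A \<theta>" unfolding Con_lat_def by simp
  have "(j a x, j c x) \<in> \<theta> \<and> (m a x, m c x) \<in> \<theta>" if "(a, c) \<in> \<theta>" "x \<in> A" for a c x
  proof -
    have "(x, x) \<in> \<theta>" "a \<in> A" "c \<in> A"
      using equiv that equiv_type[OF equiv] by (auto simp: equiv_def refl_on_def)
    moreover from this have "(a \<squnion>\<^bsub>as_gorder\<^esub> x, c \<squnion>\<^bsub>as_gorder\<^esub> x) \<in> \<theta>"
        "(a \<sqinter>\<^bsub>as_gorder\<^esub> x, c \<sqinter>\<^bsub>as_gorder\<^esub> x) \<in> \<theta>"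
      using \<theta> that(1) unfolding Con_lat_def by blast+
    ultimately show ?thesis
      using that(2) by (simp add: join_as_gorder meet_as_gorder)
  qed
  then show "\<theta> \<in> congs A j m"
    unfolding congs_def using equiv by simp
qed

text \<open>
  Stated with the meet alone, so that the ideals are the filters of the dual lattice and both are
  counted by the same lemma.
\<close>

definition "filters = {F. F \<subseteq> A \<and> F \<noteq> {} \<and> (\<forall>x\<in>F. \<forall>y\<in>F. m x y \<in> F) \<and>
  (\<forall>x\<in>F. \<forall>y\<in>A. m x y = x \<longrightarrow> y \<in> F)}"

lemma filter_has_least:
  assumes "finite A" and F: "F \<in> filters"
  obtains a where "a \<in> F" "\<And>y. y \<in> F \<Longrightarrow> m a y = a"
proof -
  have F': "F \<subseteq> A" "F \<noteq> {}" "\<And>x y. x \<in> F \<Longrightarrow> y \<in> F \<Longrightarrow> m x y \<in> F"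
    using F unfolding filters_def by blast+
  have "\<exists>a\<in>F. \<forall>y\<in>G. m a y = a" if "finite G" "G \<subseteq> F" for G
    using that
  proof (induction rule: finite_induct)
    case empty
    then show ?case using F'(2) by blast
  next
    case (insert w G)
    then obtain a where a: "a \<in> F" "\<forall>y\<in>G. m a y = a" "w \<in> F" "G \<subseteq> F" by blast
    then have in_A: "a \<in> A" "w \<in> A" "\<And>y. y \<in> G \<Longrightarrow> y \<in> A" using F'(1) by blast+
    have "m (m a w) w = m a w" using in_A by (metis m_assoc m_idem)
    moreover have "m (m a w) y = m a w" if "y \<in> G" for y
      using in_A that a(2) by (metis m_assoc m_comm)
    ultimately show ?case using F'(3)[OF a(1,3)] by blast
  qed
  from this[OF finite_subset[OF F'(1) assms(1)] subset_refl] show thesis using that by blast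
qed

lemma bij_filters:
  assumes "finite A"
  shows "bij_betw (\<lambda>a. {y \<in> A. m a y = a}) A filters"
  unfolding bij_betw_def
proof (intro conjI inj_onI equalityI subsetI)
  fix a c assume ac: "a \<in> A" "c \<in> A" "{y \<in> A. m a y = a} = {y \<in> A. m c y = c}"
  then have "m a c = a" "m c a = c" using m_idem by blast+
  then show "a = c" using ac m_comm by metis
next
  fix F assume "F \<in> (\<lambda>a. {y \<in> A. m a y = a}) ` A"
  then obtain a where a: "a \<in> A" "F = {y \<in> A. m a y = a}" by blast
  have "m a (m x y) = a" if "x \<in> A" "y \<in> A" "m a x = a" "m a y = a" for x y
    using that a(1) by (metis m_assoc)
  moreover have "m a y = a" if "x \<in> A" "y \<in> A" "m a x = a" "m x y = x" for x y
    using that a(1) by (metis m_assoc)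
  moreover have "a \<in> F" using a by simp
  ultimately show "F \<in> filters" unfolding filters_def a(2) by auto
next
  fix F assume F: "F \<in> filters"
  obtain a where a: "a \<in> F" "\<And>y. y \<in> F \<Longrightarrow> m a y = a" using filter_has_least[OF assms F] by metis
  have "F = {y \<in> A. m a y = a}" "a \<in> A" using F a unfolding filters_def by blast+
  then show "F \<in> (\<lambda>a. {y \<in> A. m a y = a}) ` A" by blast
qed

lemma Filt_lat_as_gorder: "Filt_lat as_gorder = filters"
  unfolding Filt_lat_def filters_def as_gorder_simps
  by (intro Collect_cong conj_cong refl ball_cong) (auto simp: meet_as_gorder subset_iff)

lemma Id_lat_as_gorder: "Id_lat as_gorder = lattice_ops.filters A j"
proof -
  interpret d: lattice_ops A m j by (rule dual)
  have "m y x = y \<longleftrightarrow> j x y = x" if "x \<in> A" "y \<in> A" for x y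
    using that by (metis m_eq_iff j_comm)
  then show ?thesis
    unfolding Id_lat_def d.filters_def as_gorder_simps
    by (intro Collect_cong conj_cong refl ball_cong) (auto simp: join_as_gorder subset_iff)
qed

end

lemma CFI_representable_if_realizable:
  assumes "realizable n k"
  shows "CFI_representable ( |{..<k}| ) ( |{..<n}| ) ( |{..<n}| )"
proof -
  obtain A :: "nat set" and j m b t where A: "bounded_lattice_ops A j m b t"
    "finite A" "card A = n" "card (congs A j m) = k"
    using assms unfolding realizable_def by blast
  interpret bounded_lattice_ops A j m b t by fact
  interpret d: lattice_ops A m j by (rule dual)
  have iso: "|X| =o |{..<i}|" if "finite X" "card X = i" for X :: "'b set" and i :: nat
    using finite_same_card_bij[of X "{..<i}"] that card_of_ordIso[of X "{..<i}"] by simp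
  have filt: "finite filters" "card filters = n" "finite d.filters" "card d.filters = n"
    using bij_betw_finite[OF bij_filters[OF A(2)]] bij_betw_same_card[OF bij_filters[OF A(2)]]
      bij_betw_finite[OF d.bij_filters[OF A(2)]] bij_betw_same_card[OF d.bij_filters[OF A(2)]]
      A(2,3) by simp_all
  show ?thesis
  proof (rule CFI_representableI[of as_gorder])
    show "lattice as_gorder" by (rule lattice)
    show "carrier as_gorder \<noteq> {}" unfolding as_gorder_simps using b_in by blast
  qed (simp_all add: iso Con_lat_as_gorder Filt_lat_as_gorder Id_lat_as_gorder filt finite_congs A)
qed

theorem proposition4p1:
  fixes n :: nat
  assumes "n \<ge> 7"
  shows "(\<forall>j::nat. 1 \<le> j \<and> j \<le> n - 1 \<longrightarrow>
            CFI_representable ( |{..<(2::nat) ^ j}| ) ( |{..<n}| ) ( |{..<n}| )) \<and>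
         (n \<noteq> 8 \<longrightarrow> (\<forall>k::nat. 2 \<le> k \<and> k \<le> n + 1 \<longrightarrow>
            CFI_representable ( |{..<k}| ) ( |{..<n}| ) ( |{..<n}| )))"
  using assms realizable_power_two realizable_small CFI_representable_if_realizable by simp

end
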